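(* Let $\theta\in(0,1]$ and $b>0$. Let $(Z_n)_{n\ge 0}$ be a (critical) Galton-Watson process with one ancestor ($Z_0=1$) and offspring distribution $\mathsf{PF}(\theta,1,b)$. Then: (a) $$\lim_{n\to\infty}n^{1/\theta}\,\mathbb{P}(Z_n>0)=b^{-1/\theta}\qquad\text{and}\qquad \lim_{n\to\infty}n^{-1/\theta}\,\mathbb{E}(Z_n\,|\,Z_n>0)=b^{1/\theta}.$$ (b) The conditional law of $(bn)^{-1/\theta}Z_n$ given $Z_n>0$ converges weakly as $n\to\infty$: $$\mathbb{P}\Big(\frac{Z_n}{(bn)^{1/\theta}}\in\cdot\,\Big|\,Z_n>0\Big)\ \xrightarrow{\;w\;}\ \mathsf{CPF}_+(\theta,1).$$
   Context: For $\theta\in(0,1]$ and $a,b>0$ with $a+b\ge 1$, the power-fractional law $\mathsf{PF}(\theta,a,b)$ (three parameters $\theta,a,b$ in this order) is the probability distribution on $\mathbb{N}_0$ with probability generating function $f(s)=1-\big[\frac{a}{(1-s)^{\theta}}+b\big]^{-1/\theta}$ for $s\in[0,1)$, $f(1)=1$. Its mean is $a^{-1/\theta}$; the case $a=1$ is called critical. For $\theta\in(0,1]$ and $\alpha>0$, $\mathsf{CPF}_+(\theta,\alpha)$ denotes the continuous power-fractional law on the positive halfline, i.e. the probability distribution with Laplace transform $u\mapsto 1-\big(\frac{u^{\theta}}{u^{\theta}+\alpha}\big)^{1/\theta}$, $u\ge 0$. *)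

theory Defs
  imports "HOL-Probability.Probability"
begin

definition pgf :: "nat pmf \<Rightarrow> real \<Rightarrow> real" where
  "pgf p s = measure_pmf.expectation p (\<lambda>k. s ^ k)"

text \<open>
  The law \<open>PF(\<theta>,a,b)\<close>, as a property of a distribution \<open>p\<close> on the natural numbers. A distribution is
  determined by its generating function on \<open>[0,1)\<close>, so at most one \<open>p\<close> has the property; the value
  \<open>1\<close> at \<open>s = 1\<close> is automatic. The parameters are meant to satisfy \<open>0 < \<theta> \<le> 1\<close>, \<open>a, b > 0\<close> and
  \<open>a + b \<ge> 1\<close>.
\<close>

definition is_PF :: "real \<Rightarrow> real \<Rightarrow> real \<Rightarrow> nat pmf \<Rightarrow> bool" where
  "is_PF \<theta> a b p \<longleftrightarrow>
     (\<forall>s\<in>{0..<1}. pgf p s = 1 - (a / (1 - s) powr \<theta> + b) powr (- 1 / \<theta>))"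

definition laplace_transform :: "real measure \<Rightarrow> real \<Rightarrow> real" where
  "laplace_transform \<mu> u = (\<integral>x. exp (- u * x) \<partial>\<mu>)"

text \<open>
  The law \<open>CPF\<^sub>+(\<theta>,\<alpha>)\<close>, as a property of a Borel probability measure on the reals. A measure on the
  halfline is determined by its Laplace transform, so at most one \<open>\<mu>\<close> has the property. The
  parameters are meant to satisfy \<open>0 < \<theta> \<le> 1\<close> and \<open>\<alpha> > 0\<close>.
\<close>

definition is_CPF_plus :: "real \<Rightarrow> real \<Rightarrow> real measure \<Rightarrow> bool" where
  "is_CPF_plus \<theta> \<alpha> \<mu> \<longleftrightarrow>
     real_distribution \<mu> \<and> (AE x in \<mu>. 0 < x) \<and>
     (\<forall>u\<ge>0. laplace_transform \<mu> u = 1 - (u powr \<theta> / (u powr \<theta> + \<alpha>)) powr (1 / \<theta>))"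

text \<open>
  \<open>Z\<close> is a Galton-Watson process with one ancestor and offspring law \<open>p\<close>; \<open>\<xi> (n, i)\<close> is the number
  of children of individual \<open>i\<close> of generation \<open>n\<close>.
\<close>

definition galton_watson :: "'a measure \<Rightarrow> nat pmf \<Rightarrow> (nat \<Rightarrow> 'a \<Rightarrow> nat) \<Rightarrow> bool" where
  "galton_watson M p Z \<longleftrightarrow> prob_space M \<and>
     (\<exists>\<xi> :: nat \<times> nat \<Rightarrow> 'a \<Rightarrow> nat.
        prob_space.indep_vars M (\<lambda>_. count_space UNIV) \<xi> UNIV \<and>
        (\<forall>j. distr M (count_space UNIV) (\<xi> j) = measure_pmf p) \<and>
        (\<forall>\<omega>\<in>space M. Z 0 \<omega> = 1) \<and>
        (\<forall>n. \<forall>\<omega>\<in>space M. Z (Suc n) \<omega> = (\<Sum>i<Z n \<omega>. \<xi> (n, i) \<omega>)))"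

definition cond_survival :: "'a measure \<Rightarrow> (nat \<Rightarrow> 'a \<Rightarrow> nat) \<Rightarrow> nat \<Rightarrow> 'a measure" where
  "cond_survival M Z n = uniform_measure M {\<omega> \<in> space M. Z n \<omega> > 0}"

end

(* On [0,1) the generating function f satisfies (1 - f(s))^(-\<theta>) = (1 - s)^(-\<theta>) + b, so its n-th
   iterate, the generating function of Z n, satisfies the same identity with b n in place of b. The
   extinction probability is its value at 0, the mean is its derivative at 1, and the Laplace transform
   of the rescaled conditional law is explicit and converges. The conditional means are bounded after
   rescaling, hence the laws are tight, and Laplace transforms determine laws on the halfline
   (substitute y = exp(-x) and use that moments determine laws on [0,1]), so they converge weakly. *)

theory Submission
  imports Defs "HOL-Real_Asymp.Real_Asymp"
begin

section \<open>Laplace transforms and weak convergence on the halfline\<close>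

text \<open>By Stone-Weierstrass, polynomials approximate continuous functions uniformly on
  \<open>{0..1}\<close>, so equal moments force equal integrals of \<open>cos (t * x)\<close> and
  \<open>sin (t * x)\<close>. The characteristic functions then agree and Levy's uniqueness theorem
  applies.\<close>

lemma moments_unique_unit_interval:
  fixes M N :: "real measure"
  assumes M: "real_distribution M" and N: "real_distribution N"
    and M01: "AE x in M. x \<in> {0..1}" and N01: "AE x in N. x \<in> {0..1}"
    and eq: "\<And>k::nat. (\<integral>x. x ^ k \<partial>M) = (\<integral>x. x ^ k \<partial>N)"
  shows "M = N"
proof -
  interpret M: real_distribution M by fact
  interpret N: real_distribution N by fact
  have int_pow: "integrable L (\<lambda>x. x ^ k)"
    if L: "real_distribution L" and L01: "AE x in L. x \<in> {0..1}" for L and k :: nat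
  proof -
    interpret L: real_distribution L by fact
    show ?thesis
    proof (rule L.integrable_const_bound[where B = 1])
      show "AE x in L. norm (x ^ k) \<le> 1"
        using L01 by eventually_elim (auto simp: power_le_one)
    qed simp
  qed
  have close: "\<bar>(\<integral>x. f x \<partial>L) - (\<integral>x. g x \<partial>L)\<bar> \<le> e"
    if L: "real_distribution L" and L01: "AE x in L. x \<in> {0..1}"
      and f: "integrable L f" and g: "integrable L g"
      and fg: "\<And>x. x \<in> {0..1} \<Longrightarrow> \<bar>f x - g x\<bar> < e" for L and f g :: "real \<Rightarrow> real" and e
  proof -
    interpret L: real_distribution L by fact
    have "\<bar>(\<integral>x. f x \<partial>L) - (\<integral>x. g x \<partial>L)\<bar> = \<bar>\<integral>x. f x - g x \<partial>L\<bar>"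
      using f g by simp
    also have "\<dots> \<le> (\<integral>x. \<bar>f x - g x\<bar> \<partial>L)"
      by (rule integral_abs_bound)
    also have "\<dots> \<le> (\<integral>x. e \<partial>L)"
    proof (rule integral_mono_AE)
      show "AE x in L. \<bar>f x - g x\<bar> \<le> e"
        using L01 by eventually_elim (use fg in \<open>auto intro: less_imp_le\<close>)
    qed (use f g in auto)
    also have "\<dots> = e"
      using L.prob_space by simp
    finally show ?thesis .
  qed
  have cont_eq: "(\<integral>x. f x \<partial>M) = (\<integral>x. f x \<partial>N)"
    if f: "continuous_on UNIV f" and B: "\<And>x. \<bar>f x\<bar> \<le> 1" for f :: "real \<Rightarrow> real"
  proof -
    have [measurable]: "f \<in> borel_measurable borel"
      using f by (rule borel_measurable_continuous_onI)
    have fM: "integrable M f"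
      by (rule M.integrable_const_bound[where B = 1]) (use B in auto)
    have fN: "integrable N f"
      by (rule N.integrable_const_bound[where B = 1]) (use B in auto)
    \<comment> \<open>The summand \<open>0\<close> gives the bound the shape that
      \<open>field_le_epsilon\<close> expects.\<close>
    have "\<bar>(\<integral>x. f x \<partial>M) - (\<integral>x. f x \<partial>N)\<bar> \<le> 0 + e" if e: "0 < e" for e :: real
    proof -
      obtain g where g: "real_polynomial_function g"
        and fg: "\<And>x. x \<in> {0..1} \<Longrightarrow> \<bar>f x - g x\<bar> < e / 2"
        using Stone_Weierstrass_real_polynomial_function[of "{0..1::real}" f "e / 2"]
          continuous_on_subset[OF f] e by (metis compact_Icc half_gt_zero subset_UNIV)
      obtain a n where g_def: "g = (\<lambda>x. \<Sum>i\<le>n. a i * x ^ i)"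
        using g real_polynomial_function_iff_sum by blast
      have gM: "integrable M g" and gN: "integrable N g"
        unfolding g_def using int_pow[OF M M01] int_pow[OF N N01] by auto
      have "(\<integral>x. g x \<partial>M) = (\<integral>x. g x \<partial>N)"
        unfolding g_def using int_pow[OF M M01] int_pow[OF N N01] eq
        by (simp add: Bochner_Integration.integral_sum)
      then show ?thesis
        using close[OF M M01 fM gM fg] close[OF N N01 fN gN fg] by linarith
    qed
    then show ?thesis
      using field_le_epsilon[of "\<bar>(\<integral>x. f x \<partial>M) - (\<integral>x. f x \<partial>N)\<bar>" 0] by simp
  qed
  have "char L t = Complex (\<integral>x. cos (t * x) \<partial>L) (\<integral>x. sin (t * x) \<partial>L)"
    if L: "real_distribution L" for L t
  proof -
    interpret L: real_distribution L by fact
    have i: "integrable L (\<lambda>x. iexp (t * x))"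
      by (rule L.integrable_iexp) auto
    show ?thesis
      unfolding char_def using integral_Re[OF i] integral_Im[OF i]
      by (intro complex_eqI) (simp_all add: Re_exp Im_exp)
  qed
  moreover have "(\<integral>x. cos (t * x) \<partial>M) = (\<integral>x. cos (t * x) \<partial>N)" for t
    by (rule cont_eq) (auto intro!: continuous_intros)
  moreover have "(\<integral>x. sin (t * x) \<partial>M) = (\<integral>x. sin (t * x) \<partial>N)" for t
    by (rule cont_eq) (auto intro!: continuous_intros)
  ultimately have "char M = char N"
    using M N by (simp add: fun_eq_iff)
  then show ?thesis
    by (rule Levy_uniqueness[OF M N])
qed

text \<open>The substitution \<open>exp (- x)\<close> carries the halfline into
  \<open>{0..1}\<close> and turns the transform at a natural number \<open>k\<close> into the
  \<open>k\<close>-th moment. The image laws therefore coincide, and \<open>- ln\<close> maps them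
  back.\<close>

lemma laplace_transform_unique:
  assumes M: "real_distribution M" and N: "real_distribution N"
    and M0: "AE x in M. 0 \<le> x" and N0: "AE x in N. 0 \<le> x"
    and eq: "\<And>u. 0 \<le> u \<Longrightarrow> laplace_transform M u = laplace_transform N u"
  shows "M = N"
proof -
  have D: "real_distribution (distr L borel (\<lambda>x. exp (- x)))"
    if L: "real_distribution L" for L :: "real measure"
  proof -
    interpret L: real_distribution L by fact
    show ?thesis by (rule L.real_distribution_distr) simp
  qed
  have D01: "AE x in distr L borel (\<lambda>x. exp (- x)). x \<in> {0..1}"
    if L: "real_distribution L" and L0: "AE x in L. 0 \<le> x" for L :: "real measure"
  proof -
    interpret L: real_distribution L by fact
    show ?thesis
      by (subst AE_distr_iff) (use L0 in auto)
  qed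
  have pow: "(\<integral>x. x ^ k \<partial>distr L borel (\<lambda>x. exp (- x))) = laplace_transform L (real k)"
    if L: "real_distribution L" for L :: "real measure" and k :: nat
  proof -
    interpret L: real_distribution L by fact
    show ?thesis
      unfolding laplace_transform_def
      by (subst integral_distr) (auto simp flip: exp_of_nat_mult)
  qed
  have inv: "distr (distr L borel (\<lambda>x. exp (- x))) borel (\<lambda>y. - ln y) = L"
    if L: "real_distribution L" for L :: "real measure"
  proof -
    interpret L: real_distribution L by fact
    show ?thesis
      by (subst distr_distr) (simp_all add: o_def distr_id2)
  qed
  have "distr M borel (\<lambda>x. exp (- x)) = distr N borel (\<lambda>x. exp (- x))"
    by (rule moments_unique_unit_interval) (use D D01 M N M0 N0 eq pow in auto)
  then show ?thesis
    using inv[OF M] inv[OF N] by metis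
qed

text \<open>Markov's inequality bounds the mass of \<open>{K..}\<close> by \<open>C / K\<close>,
  uniformly in \<open>n\<close>.\<close>

lemma tight_of_bounded_mean:
  fixes \<mu> :: "nat \<Rightarrow> real measure"
  assumes \<mu>: "\<And>n. real_distribution (\<mu> n)" and nonneg: "\<And>n. AE x in \<mu> n. 0 \<le> x"
    and int: "\<And>n. integrable (\<mu> n) (\<lambda>x. x)" and bound: "\<And>n. (\<integral>x. x \<partial>\<mu> n) \<le> C"
  shows "tight \<mu>"
  unfolding tight_def
proof (intro conjI allI impI)
  fix e :: real
  assume e: "0 < e"
  \<comment> \<open>The numerator \<open>\<bar>C\<bar> + 1\<close> is positive and exceeds
    \<open>C\<close>, whatever the sign of \<open>C\<close>.\<close>
  define K where "K = (\<bar>C\<bar> + 1) / e"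
  have K: "0 < K" and "K * e = \<bar>C\<bar> + 1"
    using e by (auto simp: K_def)
  then have CK: "C / K < e"
    by (simp add: pos_divide_less_eq mult.commute)
  show "\<exists>a b. a < b \<and> (\<forall>n. 1 - e < measure (\<mu> n) {a<..b})"
  \<comment> \<open>The interval \<open>{a<..b}\<close> omits its left end; a negative one keeps a
    possible atom at 0 inside.\<close>
  proof (rule exI[of _ "-1"], rule exI[of _ K], intro conjI allI)
    fix n
    interpret real_distribution "\<mu> n" by (rule \<mu>)
    have "prob {x \<in> space (\<mu> n). K \<le> x} \<le> (\<integral>x. x \<partial>\<mu> n) / K"
      by (rule integral_Markov_inequality_measure[where A = "{}"]) (use int nonneg K in auto)
    also have "\<dots> \<le> C / K"
      using bound K by (simp add: divide_right_mono)
    finally have "prob {K..} < e"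
      using CK by (simp add: atLeast_def)
    moreover have "1 - prob {K..} = prob (UNIV - {K..})"
      using prob_compl[of "{K..}"] by simp
    moreover have "prob (UNIV - {K..}) \<le> prob {-1<..K}"
      by (rule finite_measure_mono_AE) (use nonneg[of n] in auto)
    ultimately show "1 - e < prob {-1<..K}" by linarith
  qed (use K in simp)
qed (rule \<mu>)

text \<open>A continuity theorem. Tightness yields a subsequential limit; each such limit lives on
  the halfline and has transform \<open>\<phi>\<close>, so all of them coincide and the whole
  sequence converges. That \<open>\<phi>\<close> is a Laplace transform is part of the conclusion,
  which is how the limit law of the theorem is shown to exist.\<close>

lemma weak_conv_m_of_laplace_transform:
  fixes \<mu> :: "nat \<Rightarrow> real measure"
  assumes tight: "tight \<mu>" and nonneg: "\<And>n. AE x in \<mu> n. 0 \<le> x"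
    and lim: "\<And>u. 0 \<le> u \<Longrightarrow> (\<lambda>n. laplace_transform (\<mu> n) u) \<longlonglongrightarrow> \<phi> u"
  obtains \<nu> where "real_distribution \<nu>" "AE x in \<nu>. 0 \<le> x"
    "\<And>u. 0 \<le> u \<Longrightarrow> laplace_transform \<nu> u = \<phi> u" "weak_conv_m \<mu> \<nu>"
proof -
  have \<mu>: "real_distribution (\<mu> n)" for n
    using tight by (simp add: tight_def)
  have sub: "(AE x in \<nu>. 0 \<le> x) \<and> (\<forall>u\<ge>0. laplace_transform \<nu> u = \<phi> u)"
    if s: "strict_mono s" and \<nu>: "real_distribution \<nu>" and conv: "weak_conv_m (\<lambda>n. \<mu> (s n)) \<nu>" for s \<nu>
  proof -
    interpret \<nu>: real_distribution \<nu> by fact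
    have \<mu>s: "real_distribution (\<mu> (s n))" for n
      by (rule \<mu>)
    have ae: "AE x in \<nu>. 0 \<le> x"
    proof -
      \<comment> \<open>This test function is bounded and continuous, and it vanishes exactly on the
        halfline, so a zero integral in the limit says that \<open>\<nu>\<close> does not charge the
        negative numbers.\<close>
      have "(\<lambda>n. \<integral>x. min 1 (max (- x) 0) \<partial>\<mu> (s n)) \<longlonglongrightarrow> (\<integral>x. min 1 (max (- x) 0) \<partial>\<nu>)"
        by (rule weak_conv_imp_integral_bdd_continuous_conv[OF \<mu>s \<nu> conv, where B = 1])
           (auto intro!: continuous_intros)
      moreover have "(\<integral>x. min 1 (max (- x) 0) \<partial>\<mu> (s n)) = 0" for n
      proof (rule integral_eq_zero_AE)
        show "AE x in \<mu> (s n). min 1 (max (- x) 0) = 0"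
          using nonneg[of "s n"] by eventually_elim auto
      qed
      ultimately have "(\<integral>x. min 1 (max (- x) 0) \<partial>\<nu>) = 0"
        by (simp add: LIMSEQ_const_iff)
      moreover have "integrable \<nu> (\<lambda>x. min 1 (max (- x) 0))"
        by (rule \<nu>.integrable_const_bound[where B = 1]) auto
      ultimately have "AE x in \<nu>. min 1 (max (- x) 0) = 0"
        by (subst (asm) integral_nonneg_eq_0_iff_AE) auto
      then show ?thesis
        by eventually_elim (auto simp: min_def max_def split: if_splits)
    qed
    have "laplace_transform \<nu> u = \<phi> u" if u: "0 \<le> u" for u
    proof -
      \<comment> \<open>\<open>exp (- u * x)\<close> is unbounded on the negative axis when
        \<open>u > 0\<close>. Replacing \<open>x\<close> by \<open>max x 0\<close> gives a bounded
        continuous function without changing the integral for laws on the halfline.\<close>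
      have L: "laplace_transform L u = (\<integral>x. exp (- u * max x 0) \<partial>L)"
        if "AE x in L. 0 \<le> x" "real_distribution L" for L
      proof -
        interpret L: real_distribution L by fact
        show ?thesis
          unfolding laplace_transform_def
        proof (rule integral_cong_AE)
          show "AE x in L. exp (- u * x) = exp (- u * max x 0)"
            using that(1) by eventually_elim (auto simp: max_def)
        qed auto
      qed
      have "(\<lambda>n. \<integral>x. exp (- u * max x 0) \<partial>\<mu> (s n)) \<longlonglongrightarrow> (\<integral>x. exp (- u * max x 0) \<partial>\<nu>)"
        by (rule weak_conv_imp_integral_bdd_continuous_conv[OF \<mu>s \<nu> conv, where B = 1])
           (use u in \<open>auto intro!: continuous_intros\<close>)
      then have "(\<lambda>n. laplace_transform (\<mu> (s n)) u) \<longlonglongrightarrow> laplace_transform \<nu> u"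
        using L[OF nonneg \<mu>] L[OF ae \<nu>] by simp
      moreover have "(\<lambda>n. laplace_transform (\<mu> (s n)) u) \<longlonglongrightarrow> \<phi> u"
        using LIMSEQ_subseq_LIMSEQ[OF lim[OF u] s] by (simp add: o_def)
      ultimately show ?thesis by (rule LIMSEQ_unique)
    qed
    with ae show ?thesis by blast
  qed
  obtain r \<nu> where r: "strict_mono (r :: nat \<Rightarrow> nat)" and \<nu>: "real_distribution \<nu>"
    and conv: "weak_conv_m (\<mu> \<circ> id \<circ> r) \<nu>"
    using tight_imp_convergent_subsubsequence[OF tight strict_mono_id] by blast
  have \<nu>': "AE x in \<nu>. 0 \<le> x" "\<forall>u\<ge>0. laplace_transform \<nu> u = \<phi> u"
    using sub[OF r \<nu>] conv by (auto simp: o_def)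
  have "weak_conv_m \<mu> \<nu>"
  proof (rule tight_subseq_weak_converge[OF \<mu> \<nu> tight])
    fix s \<rho>
    assume s: "strict_mono s" and \<rho>: "real_distribution \<rho>" and c: "weak_conv_m (\<mu> \<circ> s) \<rho>"
    have "\<rho> = \<nu>"
      by (rule laplace_transform_unique[OF \<rho> \<nu>]) (use sub[OF s \<rho>] c \<nu>' in \<open>auto simp: o_def\<close>)
    then show "weak_conv_m (\<mu> \<circ> s) \<nu>"
      using c by simp
  qed
  then show thesis
    using that \<nu> \<nu>' by blast
qed

section \<open>Conditioning on an event, and absence of an atom at zero\<close>

lemma integral_uniform_measure:
  fixes f :: "'a \<Rightarrow> real"
  assumes A: "A \<in> sets M" "0 < measure M A" and f: "f \<in> borel_measurable M"
  shows "integral\<^sup>L (uniform_measure M A) f = (\<integral>x. indicator A x * f x \<partial>M) / measure M A"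
    and "integrable M f \<Longrightarrow> integrable (uniform_measure M A) f"
proof -
  \<comment> \<open>Infinite \<open>emeasure M A\<close> would make \<open>measure M A\<close> zero
    by convention, so positivity also gives finiteness.\<close>
  have "emeasure M A = ennreal (measure M A)"
    using A by (intro emeasure_eq_ennreal_measure) (auto simp: measure_def)
  then have eq: "uniform_measure M A = density M (\<lambda>x. ennreal (indicator A x / measure M A))"
    unfolding uniform_measure_def using A
    by (auto intro!: density_cong simp: divide_ennreal indicator_def simp flip: ennreal_1)
  have "integral\<^sup>L (uniform_measure M A) f = (\<integral>x. (indicator A x * f x) / measure M A \<partial>M)"
    unfolding eq by (subst integral_real_density) (use A f in auto)
  then show "integral\<^sup>L (uniform_measure M A) f = (\<integral>x. indicator A x * f x \<partial>M) / measure M A"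
    by simp
  assume "integrable M f"
  then have "integrable M (\<lambda>x. (indicator A x * f x) / measure M A)"
    using A by (auto intro: integrable_mult_indicator[where 'b = real, simplified])
  then show "integrable (uniform_measure M A) f"
    unfolding eq by (subst integrable_real_density) (use A f in auto)
qed

text \<open>An atom at 0 contributes its full mass to the transform at every \<open>u\<close>, so
  its mass is at most the limit 0. This provides the strict positivity demanded by
  \<open>is_CPF_plus\<close>.\<close>

lemma AE_pos_of_laplace_transform:
  assumes "real_distribution \<nu>" and nonneg: "AE x in \<nu>. 0 \<le> x"
    and lim: "(laplace_transform \<nu> \<longlongrightarrow> 0) at_top"
  shows "AE x in \<nu>. 0 < x"
proof -
  interpret real_distribution \<nu> by fact
  have "prob {0} \<le> laplace_transform \<nu> u" if u: "0 \<le> u" for u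
  proof -
    have "prob {0} = (\<integral>x. indicator {0} x \<partial>\<nu>)"
      by simp
    also have "\<dots> \<le> laplace_transform \<nu> u"
      unfolding laplace_transform_def
    proof (rule integral_mono_AE)
      show "integrable \<nu> (\<lambda>x. exp (- u * x))"
      proof (rule integrable_const_bound[where B = 1])
        show "AE x in \<nu>. norm (exp (- u * x)) \<le> 1"
          using nonneg by eventually_elim (use u in auto)
      qed simp
      show "integrable \<nu> (indicator {0} :: real \<Rightarrow> real)"
        by (rule integrable_const_bound[where B = 1]) auto
    qed (auto simp: indicator_def)
    finally show ?thesis .
  qed
  then have "prob {0} \<le> 0"
    by (intro tendsto_lowerbound[OF lim]) (auto intro: eventually_mono[OF eventually_ge_at_top[of 0]])
  then have "AE x in \<nu>. x \<notin> {0}"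
    by (subst AE_iff_measurable[of "{0}"]) (auto simp: emeasure_eq_measure measure_le_0_iff)
  with nonneg show ?thesis
    by eventually_elim auto
qed

section \<open>Generating functions of a Galton-Watson process\<close>

text \<open>Decomposes an expectation according to the value of a random index. The partial sums cut
  the integrand off to \<open>X < m\<close>, and dominated convergence with the constant 1 lets
  \<open>m\<close> grow.\<close>

lemma (in prob_space) sums_integral_nat_rv:
  fixes X :: "'a \<Rightarrow> nat" and f :: "nat \<Rightarrow> 'a \<Rightarrow> real"
  assumes X[measurable]: "X \<in> measurable M (count_space UNIV)"
    and f[measurable]: "\<And>k. f k \<in> borel_measurable M"
    and bound: "\<And>k \<omega>. \<bar>f k \<omega>\<bar> \<le> 1"
  shows "(\<lambda>k. \<integral>\<omega>. indicator {k} (X \<omega>) * f k \<omega> \<partial>M) sums (\<integral>\<omega>. f (X \<omega>) \<omega> \<partial>M)"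
  unfolding sums_def
proof -
  have int: "integrable M (\<lambda>\<omega>. indicator {k} (X \<omega>) * f k \<omega>)" for k
    by (rule integrable_const_bound[where B = 1]) (use bound in \<open>auto simp: indicator_def\<close>)
  have part: "(\<Sum>k<m. indicator {k} (X \<omega>) * f k \<omega>) = indicator {..<m} (X \<omega>) * f (X \<omega>) \<omega>" for m \<omega>
  proof -
    have "(\<Sum>k<m. indicator {k} (X \<omega>) * f k \<omega>) = (\<Sum>k<m. if X \<omega> = k then f k \<omega> else 0)"
      by (intro sum.cong) (auto simp: indicator_def)
    then show ?thesis by (simp add: indicator_def)
  qed
  have [measurable]: "(\<lambda>\<omega>. f (X \<omega>) \<omega>) \<in> borel_measurable M"
    by (rule measurable_compose_countable) auto
  have "(\<lambda>m. \<integral>\<omega>. indicator {..<m} (X \<omega>) * f (X \<omega>) \<omega> \<partial>M) \<longlonglongrightarrow> (\<integral>\<omega>. f (X \<omega>) \<omega> \<partial>M)"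
  proof (rule integral_dominated_convergence[where w = "\<lambda>_. 1"])
    show "AE \<omega> in M. (\<lambda>m. indicator {..<m} (X \<omega>) * f (X \<omega>) \<omega>) \<longlonglongrightarrow> f (X \<omega>) \<omega>"
    proof (rule AE_I2, rule tendsto_eventually)
      show "\<forall>\<^sub>F m in sequentially. indicator {..<m} (X \<omega>) * f (X \<omega>) \<omega> = f (X \<omega>) \<omega>" for \<omega>
        using eventually_gt_at_top[of "X \<omega>"] by eventually_elim simp
    qed
  qed (use bound in \<open>auto simp: indicator_def\<close>)
  then show "(\<lambda>m. \<Sum>k<m. \<integral>\<omega>. indicator {k} (X \<omega>) * f k \<omega> \<partial>M) \<longlonglongrightarrow> (\<integral>\<omega>. f (X \<omega>) \<omega> \<partial>M)"
    using int by (simp add: part flip: Bochner_Integration.integral_sum)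
qed

text \<open>Makes explicit that generation \<open>n\<close> depends only on the offspring numbers of earlier generations,
  and so is independent of the offspring numbers of generation \<open>n\<close> itself.\<close>

primrec generation_size :: "(nat \<times> nat \<Rightarrow> nat) \<Rightarrow> nat \<Rightarrow> nat" where
  "generation_size w 0 = 1"
| "generation_size w (Suc n) = (\<Sum>i<generation_size w n. w (n, i))"

text \<open>The recursion for generation \<open>n\<close> reads only coordinates
  \<open>(m, i)\<close> with \<open>m < n\<close>, so the default value of \<open>restrict\<close>
  outside the index set is never seen.\<close>

lemma generation_size_restrict:
  "n \<le> N \<Longrightarrow> generation_size (restrict w ({..<N} \<times> UNIV)) n = generation_size w n"
  by (induction n) auto

lemma measurable_sum_nat:
  fixes f :: "nat \<Rightarrow> 'a \<Rightarrow> nat"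
  assumes [measurable]: "\<And>i. f i \<in> measurable M (count_space UNIV)"
  shows "(\<lambda>\<omega>. \<Sum>i<k. f i \<omega>) \<in> measurable M (count_space UNIV)"
  by measurable

text \<open>Keeping \<open>N\<close> apart from \<open>n\<close> holds the product space fixed
  during the induction. The random number of summands is treated by splitting over its countably
  many values.\<close>

lemma measurable_generation_size:
  "n \<le> N \<Longrightarrow> (\<lambda>w. generation_size w n)
     \<in> measurable (PiM ({..<N} \<times> UNIV) (\<lambda>_. count_space UNIV)) (count_space (UNIV :: nat set))"
proof (induction n)
  case (Suc n)
  have comp: "(\<lambda>w. w (n, i))
      \<in> measurable (PiM ({..<N} \<times> UNIV) (\<lambda>_. count_space UNIV)) (count_space (UNIV :: nat set))" for i :: nat
    using Suc.prems by (intro measurable_component_singleton) auto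
  have "(\<lambda>w. (\<lambda>k w. \<Sum>i<k. w (n, i)) (generation_size w n) w)
     \<in> measurable (PiM ({..<N} \<times> UNIV) (\<lambda>_. count_space UNIV)) (count_space (UNIV :: nat set))"
  proof (rule measurable_compose_countable[where f = "\<lambda>k w. \<Sum>i<k. w (n, i)" and g = "\<lambda>w. generation_size w n"])
    show "(\<lambda>w. generation_size w n)
       \<in> measurable (PiM ({..<N} \<times> UNIV) (\<lambda>_. count_space UNIV)) (count_space (UNIV :: nat set))"
      using Suc by simp
    show "(\<lambda>w. \<Sum>i<k. w (n, i))
      \<in> measurable (PiM ({..<N} \<times> UNIV) (\<lambda>_. count_space UNIV)) (count_space (UNIV :: nat set))" for k :: nat
      by (rule measurable_sum_nat) (rule comp)
  qed
  then show ?case by simp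
qed simp

lemma galton_watson_measurable:
  assumes "galton_watson M p Z"
  shows "Z n \<in> measurable M (count_space UNIV)"
proof -
  from assms obtain \<xi> :: "nat \<times> nat \<Rightarrow> 'a \<Rightarrow> nat"
    where "prob_space M" and indep: "prob_space.indep_vars M (\<lambda>_. count_space UNIV) \<xi> UNIV"
      and Z0: "\<And>\<omega>. \<omega> \<in> space M \<Longrightarrow> Z 0 \<omega> = 1"
      and ZSuc: "\<And>n \<omega>. \<omega> \<in> space M \<Longrightarrow> Z (Suc n) \<omega> = (\<Sum>i<Z n \<omega>. \<xi> (n, i) \<omega>)"
    unfolding galton_watson_def by blast
  interpret prob_space M by fact
  have [measurable]: "\<xi> j \<in> measurable M (count_space UNIV)" for j
    using indep unfolding indep_vars_def by blast
  show ?thesis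
  proof (induction n)
    case 0
    then show ?case using Z0 by (subst measurable_cong[where g = "\<lambda>_. 1"]) auto
  next
    case (Suc n)
    have "(\<lambda>\<omega>. (\<lambda>k \<omega>. \<Sum>i<k. \<xi> (n, i) \<omega>) (Z n \<omega>) \<omega>) \<in> measurable M (count_space UNIV)"
      by (rule measurable_compose_countable[OF _ Suc]) measurable
    then show ?case using ZSuc by (subst measurable_cong) auto
  qed
qed

text \<open>The branching property: on \<open>Z n = k\<close> the next generation is a sum of
  \<open>k\<close> independent offspring numbers that are independent of \<open>Z n\<close>, so
  conditioning replaces \<open>s\<close> by \<open>pgf p s\<close>. Repeated use yields the iterates
  of the offspring generating function.\<close>

lemma galton_watson_pgf_Suc:
  assumes gw: "galton_watson M p Z" and s: "0 \<le> s" "s \<le> 1"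
  shows "(\<integral>\<omega>. s ^ Z (Suc n) \<omega> \<partial>M) = (\<integral>\<omega>. pgf p s ^ Z n \<omega> \<partial>M)"
proof -
  from gw obtain \<xi> :: "nat \<times> nat \<Rightarrow> 'a \<Rightarrow> nat"
    where "prob_space M" and indep: "prob_space.indep_vars M (\<lambda>_. count_space UNIV) \<xi> UNIV"
      and law: "\<And>j. distr M (count_space UNIV) (\<xi> j) = measure_pmf p"
      and Z0: "\<And>\<omega>. \<omega> \<in> space M \<Longrightarrow> Z 0 \<omega> = 1"
      and ZSuc: "\<And>n \<omega>. \<omega> \<in> space M \<Longrightarrow> Z (Suc n) \<omega> = (\<Sum>i<Z n \<omega>. \<xi> (n, i) \<omega>)"
    unfolding galton_watson_def by blast
  interpret prob_space M by fact
  note [measurable] = galton_watson_measurable[OF gw]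
  have [measurable]: "\<xi> j \<in> measurable M (count_space UNIV)" for j
    using indep unfolding indep_vars_def by blast
  \<comment> \<open>Expressing \<open>Z\<close> through the family \<open>\<xi>\<close> makes the
    independence of \<open>\<xi>\<close> applicable to it.\<close>
  have Z_gen: "Z m \<omega> = generation_size (\<lambda>j. \<xi> j \<omega>) m" if "\<omega> \<in> space M" for m \<omega>
    using that by (induction m) (auto simp: Z0 ZSuc)
  have pgf01: "0 \<le> pgf p s" "pgf p s \<le> 1"
  proof -
    show "0 \<le> pgf p s"
      unfolding pgf_def using s by (intro integral_nonneg_AE) auto
    show "pgf p s \<le> 1"
      unfolding pgf_def using s
      by (intro measure_pmf.integral_le_const measure_pmf.integrable_const_bound[where B = 1])
         (auto simp: power_le_one)
  qed
  have \<xi>_pgf: "(\<integral>\<omega>. s ^ \<xi> j \<omega> \<partial>M) = pgf p s" for j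
    unfolding pgf_def law[of j, symmetric] by (subst integral_distr) auto
  have prod_pgf: "(\<integral>\<omega>. (\<Prod>i<k. s ^ \<xi> (n, i) \<omega>) \<partial>M) = pgf p s ^ k" for k
  proof -
    have "indep_vars (\<lambda>_. borel) (\<lambda>j \<omega>. s ^ \<xi> j \<omega>) ((\<lambda>i. (n, i)) ` {..<k})"
      by (rule indep_vars_compose2[OF indep_vars_subset[OF indep]]) auto
    then have "(\<integral>\<omega>. (\<Prod>j\<in>(\<lambda>i. (n, i)) ` {..<k}. s ^ \<xi> j \<omega>) \<partial>M)
        = (\<Prod>j\<in>(\<lambda>i. (n, i)) ` {..<k}. \<integral>\<omega>. s ^ \<xi> j \<omega> \<partial>M)"
    proof (intro indep_vars_lebesgue_integral)
      show "integrable M (\<lambda>\<omega>. s ^ \<xi> j \<omega>)" for j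
        by (rule integrable_const_bound[where B = 1]) (use s in \<open>auto simp: power_le_one\<close>)
    qed auto
    then show ?thesis
      by (simp add: prod.reindex card_image inj_on_def \<xi>_pgf)
  qed
  have split: "(\<integral>\<omega>. indicator {k} (Z n \<omega>) * (\<Prod>i<k. s ^ \<xi> (n, i) \<omega>) \<partial>M)
      = (\<integral>\<omega>. indicator {k} (Z n \<omega>) * pgf p s ^ k \<partial>M)" for k
  proof -
    \<comment> \<open>The index blocks are disjoint: \<open>?A\<close> holds the generations before
      \<open>n\<close> and determines \<open>Z n\<close>, while \<open>?B\<close> is generation
      \<open>n\<close> itself. Hence \<open>?X\<close> and \<open>?Y\<close> are independent and the
      expectation of their product factorizes.\<close>
    let ?A = "{..<n} \<times> (UNIV :: nat set)" and ?B = "{n} \<times> (UNIV :: nat set)"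
    let ?C = "\<lambda>_ :: nat \<times> nat. count_space (UNIV :: nat set)"
    let ?X = "(\<lambda>w. indicator {k} (generation_size w n) :: real) \<circ> (\<lambda>\<omega>. restrict (\<lambda>j. \<xi> j \<omega>) ?A)"
    let ?Y = "(\<lambda>w. \<Prod>i<k. s ^ w (n, i)) \<circ> (\<lambda>\<omega>. restrict (\<lambda>j. \<xi> j \<omega>) ?B)"
    have indXY: "indep_var borel ?X borel ?Y"
    proof (rule indep_var_compose[OF indep_var_restrict[OF indep]])
      show "(\<lambda>w. indicator {k} (generation_size w n) :: real) \<in> borel_measurable (PiM ?A ?C)"
        by (rule measurable_compose[OF measurable_generation_size[OF order_refl]]) simp
      have [measurable]: "(\<lambda>w. w (n, i)) \<in> measurable (PiM ?B ?C) (count_space UNIV)" for i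
        by (rule measurable_component_singleton) simp
      show "(\<lambda>w. \<Prod>i<k. s ^ w (n, i)) \<in> borel_measurable (PiM ?B ?C)"
        by measurable
    qed auto
    have X: "?X \<omega> = indicator {k} (Z n \<omega>)" if "\<omega> \<in> space M" for \<omega>
      using that by (simp add: generation_size_restrict Z_gen)
    have Y: "?Y \<omega> = (\<Prod>i<k. s ^ \<xi> (n, i) \<omega>)" for \<omega>
      by simp
    have intX: "integrable M ?X"
    proof (rule Bochner_Integration.integrable_cong[THEN iffD2])
      show "integrable M (\<lambda>\<omega>. indicator {k} (Z n \<omega>) :: real)"
        by (rule integrable_const_bound[where B = 1]) (auto simp: indicator_def)
    qed (use X in auto)
    have intY: "integrable M ?Y"
      unfolding Y
      by (rule integrable_const_bound[where B = 1])
         (use s in \<open>auto simp: abs_prod intro!: prod_le_1 power_le_one\<close>)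
    have "(\<integral>\<omega>. indicator {k} (Z n \<omega>) * (\<Prod>i<k. s ^ \<xi> (n, i) \<omega>) \<partial>M) = (\<integral>\<omega>. ?X \<omega> * ?Y \<omega> \<partial>M)"
      by (rule Bochner_Integration.integral_cong[OF refl]) (use X Y in metis)
    also have "\<dots> = (\<integral>\<omega>. ?X \<omega> \<partial>M) * (\<integral>\<omega>. ?Y \<omega> \<partial>M)"
      by (rule indep_var_lebesgue_integral[OF indXY intX intY])
    also have "(\<integral>\<omega>. ?X \<omega> \<partial>M) = (\<integral>\<omega>. indicator {k} (Z n \<omega>) \<partial>M)"
      by (rule Bochner_Integration.integral_cong[OF refl X])
    also have "(\<integral>\<omega>. ?Y \<omega> \<partial>M) = pgf p s ^ k"
      unfolding Y by (rule prod_pgf)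
    finally show ?thesis by simp
  qed
  have "(\<lambda>k. \<integral>\<omega>. indicator {k} (Z n \<omega>) * (\<Prod>i<k. s ^ \<xi> (n, i) \<omega>) \<partial>M)
      sums (\<integral>\<omega>. (\<Prod>i<Z n \<omega>. s ^ \<xi> (n, i) \<omega>) \<partial>M)"
    by (rule sums_integral_nat_rv) (use s in \<open>auto simp: abs_prod intro!: prod_le_1 power_le_one\<close>)
  moreover have "(\<lambda>k. \<integral>\<omega>. indicator {k} (Z n \<omega>) * pgf p s ^ k \<partial>M) sums (\<integral>\<omega>. pgf p s ^ Z n \<omega> \<partial>M)"
    by (rule sums_integral_nat_rv) (use pgf01 in \<open>auto simp: power_le_one\<close>)
  ultimately have "(\<integral>\<omega>. (\<Prod>i<Z n \<omega>. s ^ \<xi> (n, i) \<omega>) \<partial>M) = (\<integral>\<omega>. pgf p s ^ Z n \<omega> \<partial>M)"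
    unfolding split by (rule sums_unique2)
  moreover have "(\<integral>\<omega>. s ^ Z (Suc n) \<omega> \<partial>M) = (\<integral>\<omega>. (\<Prod>i<Z n \<omega>. s ^ \<xi> (n, i) \<omega>) \<partial>M)"
    by (rule Bochner_Integration.integral_cong) (auto simp: ZSuc power_sum)
  ultimately show ?thesis by simp
qed

section \<open>Closed forms for critical power-fractional offspring\<close>

text \<open>With \<open>x\<close> the bracket in the definition, \<open>1 - pgf p s\<close> is
  \<open>x powr (- 1 / \<theta>)\<close>, and the power \<open>- \<theta>\<close> recovers
  \<open>x\<close>. Since \<open>x > 1\<close>, the value stays in \<open>[0, 1)\<close>, so the
  identity can be iterated.\<close>

lemma is_PF_critical_pgf:
  assumes \<theta>: "0 < \<theta>" and b: "0 < b" and p: "is_PF \<theta> 1 b p" and s: "0 \<le> s" "s < 1"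
  shows "0 \<le> pgf p s" "pgf p s < 1"
    "(1 - pgf p s) powr (- \<theta>) = (1 - s) powr (- \<theta>) + b"
proof -
  define x where "x = (1 - s) powr (- \<theta>) + b"
  have "1 \<le> (1 - s) powr (- \<theta>)"
    using s \<theta> powr_mono'[of "- \<theta>" 0 "1 - s"] by simp
  then have x: "1 < x"
    using b by (simp add: x_def)
  have eq: "1 - pgf p s = x powr (- 1 / \<theta>)"
    using p s by (simp add: is_PF_def x_def powr_minus divide_inverse)
  have "0 < x powr (- 1 / \<theta>)" "x powr (- 1 / \<theta>) \<le> 1"
    using x \<theta> powr_mono[of "- 1 / \<theta>" 0 x] by auto
  then show "0 \<le> pgf p s" "pgf p s < 1"
    using eq by linarith+
  show "(1 - pgf p s) powr (- \<theta>) = (1 - s) powr (- \<theta>) + b"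
    unfolding eq using x \<theta> by (simp add: powr_powr flip: x_def)
qed

text \<open>In the coordinate \<open>(1 - s) powr (- \<theta>)\<close> each generation is a
  translation by \<open>b\<close>, so \<open>n\<close> generations translate by
  \<open>b * real n\<close>.\<close>

lemma galton_watson_PF_pgf:
  assumes \<theta>: "0 < \<theta>" and b: "0 < b" and p: "is_PF \<theta> 1 b p" and gw: "galton_watson M p Z"
    and s: "0 \<le> s" "s < 1"
  shows "(\<integral>\<omega>. s ^ Z n \<omega> \<partial>M) = 1 - ((1 - s) powr (- \<theta>) + b * real n) powr (- 1 / \<theta>)"
  using s
\<comment> \<open>The induction hypothesis is needed at \<open>pgf p s\<close> in place of
  \<open>s\<close>.\<close>
proof (induction n arbitrary: s)
  case 0
  interpret prob_space M using gw by (simp add: galton_watson_def)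
  have "(\<integral>\<omega>. s ^ Z 0 \<omega> \<partial>M) = (\<integral>\<omega>. s \<partial>M)"
    by (rule Bochner_Integration.integral_cong) (use gw in \<open>auto simp: galton_watson_def\<close>)
  then show ?case
    using 0 \<theta> prob_space by (simp add: powr_powr)
next
  case (Suc n)
  note f = is_PF_critical_pgf[OF \<theta> b p Suc.prems]
  have "(\<integral>\<omega>. s ^ Z (Suc n) \<omega> \<partial>M) = (\<integral>\<omega>. pgf p s ^ Z n \<omega> \<partial>M)"
    by (rule galton_watson_pgf_Suc[OF gw]) (use Suc.prems in auto)
  also have "\<dots> = 1 - ((1 - pgf p s) powr (- \<theta>) + b * real n) powr (- 1 / \<theta>)"
    by (rule Suc.IH[OF f(1,2)])
  finally show ?case
    by (simp add: f(3) algebra_simps)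
qed

lemma galton_watson_PF_survival:
  assumes \<theta>: "0 < \<theta>" and b: "0 < b" and p: "is_PF \<theta> 1 b p" and gw: "galton_watson M p Z"
  shows "\<P>(\<omega> in M. Z n \<omega> > 0) = (1 + b * real n) powr (- 1 / \<theta>)"
proof -
  interpret prob_space M using gw by (simp add: galton_watson_def)
  note [measurable] = galton_watson_measurable[OF gw]
  \<comment> \<open>As \<open>0 ^ 0 = 1\<close>, the generating function at 0 is the extinction
    probability.\<close>
  have "(\<integral>\<omega>. 0 ^ Z n \<omega> \<partial>M) = (\<integral>\<omega>. indicator {\<omega> \<in> space M. \<not> Z n \<omega> > 0} \<omega> \<partial>M :: real)"
    by (rule Bochner_Integration.integral_cong) (auto simp: indicator_def)
  also have "\<dots> = \<P>(\<omega> in M. \<not> Z n \<omega> > 0)"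
    by simp
  also have "\<dots> = 1 - \<P>(\<omega> in M. Z n \<omega> > 0)"
    by (rule prob_neg) simp
  finally show ?thesis
    using galton_watson_PF_pgf[OF \<theta> b p gw, of 0 n] by simp
qed

text \<open>The mean is the limit of the difference quotients \<open>(1 - E s\<^sup>Z) / (1 - s)\<close> of the generating function
  as \<open>s = m / (m + 1)\<close> increases to \<open>1\<close>.\<close>

lemma galton_watson_PF_mean:
  assumes \<theta>: "0 < \<theta>" and b: "0 < b" and p: "is_PF \<theta> 1 b p" and gw: "galton_watson M p Z"
  shows "integrable M (\<lambda>\<omega>. real (Z n \<omega>))" and "(\<integral>\<omega>. real (Z n \<omega>) \<partial>M) = 1"
proof -
  interpret prob_space M using gw by (simp add: galton_watson_def)
  note [measurable] = galton_watson_measurable[OF gw]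
  define s where "s m = 1 - 1 / (real m + 1)" for m
  have s: "0 \<le> s m" "s m < 1" for m
    by (auto simp: s_def field_simps)
  have int_pow: "integrable M (\<lambda>\<omega>. s m ^ Z n \<omega>)" for m
    by (rule integrable_const_bound[where B = 1]) (use s[of m] in \<open>auto simp: power_le_one\<close>)
  \<comment> \<open>Here \<open>1 / (1 - s m)\<close> is \<open>real m + 1\<close>. Written as a
    geometric sum, the difference quotient visibly increases in \<open>m\<close> to
    \<open>k\<close>, as monotone convergence requires.\<close>
  have quot: "(\<Sum>i<k. s m ^ i) = (real m + 1) * (1 - s m ^ k)" for m k
    by (subst sum_gp_strict) (auto simp: s_def)
  have int: "integrable M (\<lambda>\<omega>. \<Sum>i<Z n \<omega>. s m ^ i)" for m
    unfolding quot using int_pow by simp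
  have mono: "mono (\<lambda>m. \<Sum>i<k. s m ^ i)" for k
    by (intro monoI sum_mono power_mono s) (auto simp: s_def intro!: divide_left_mono)
  have "s \<longlonglongrightarrow> 1"
    unfolding s_def by real_asymp
  then have lim: "(\<lambda>m. \<Sum>i<k. s m ^ i) \<longlonglongrightarrow> real k" for k
    by (auto intro!: tendsto_eq_intros)
  have "(\<integral>\<omega>. (\<Sum>i<Z n \<omega>. s m ^ i) \<partial>M)
      = (real m + 1) * ((real m + 1) powr \<theta> + b * real n) powr (- 1 / \<theta>)" for m
  proof -
    have "(1 - s m) powr (- \<theta>) = (real m + 1) powr \<theta>"
      by (simp add: s_def powr_minus powr_divide)
    then show ?thesis
      unfolding quot using int_pow galton_watson_PF_pgf[OF \<theta> b p gw s, of m n] prob_space by simp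
  qed
  \<comment> \<open>The expression equals \<open>(1 + b * real n / (real m + 1) powr \<theta>) powr
    (- 1 / \<theta>)\<close>, whose base tends to 1.\<close>
  moreover have "(\<lambda>m. (real m + 1) * ((real m + 1) powr \<theta> + b * real n) powr (- 1 / \<theta>)) \<longlonglongrightarrow> 1"
    using \<theta> by real_asymp
  ultimately have lim_int: "(\<lambda>m. \<integral>\<omega>. (\<Sum>i<Z n \<omega>. s m ^ i) \<partial>M) \<longlonglongrightarrow> 1"
    by simp
  have meas: "(\<lambda>\<omega>. real (Z n \<omega>)) \<in> borel_measurable M"
    by measurable
  show "integrable M (\<lambda>\<omega>. real (Z n \<omega>))"
    by (rule integrable_monotone_convergence[OF int _ _ lim_int meas]) (use mono lim in auto)
  show "(\<integral>\<omega>. real (Z n \<omega>) \<partial>M) = 1"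
    by (rule integral_monotone_convergence[OF int _ _ lim_int meas]) (use mono lim in auto)
qed

section \<open>Limits of the explicit formulas\<close>

lemma survival_limit:
  fixes \<theta> b :: real
  assumes "0 < \<theta>" "0 < b"
  shows "(\<lambda>n. real n powr (1 / \<theta>) * (1 + b * real n) powr (- 1 / \<theta>)) \<longlonglongrightarrow> b powr (- 1 / \<theta>)"
  using assms by real_asymp

lemma mean_limit:
  fixes \<theta> b :: real
  assumes "0 < \<theta>" "0 < b"
  shows "(\<lambda>n. real n powr (- 1 / \<theta>) * (1 + b * real n) powr (1 / \<theta>)) \<longlonglongrightarrow> b powr (1 / \<theta>)"
  using assms by real_asymp

text \<open>With \<open>c n = (b * real n) powr (1 / \<theta>)\<close>, dividing numerator and
  denominator by \<open>b * real n\<close> puts a factor \<open>c n\<close> next to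
  \<open>1 - exp (- u / c n)\<close>. Their product tends to \<open>u\<close>, so the quotient tends
  to \<open>u powr (- \<theta>) + 1\<close>.\<close>

lemma laplace_limit:
  fixes \<theta> b u :: real
  assumes \<theta>: "0 < \<theta>" and b: "0 < b" and u: "0 < u"
  shows "(\<lambda>n. 1 - (((1 - exp (- u / (b * real n) powr (1 / \<theta>))) powr (- \<theta>) + b * real n) / (1 + b * real n)) powr (- 1 / \<theta>))
    \<longlonglongrightarrow> 1 - (u powr \<theta> / (u powr \<theta> + 1)) powr (1 / \<theta>)"
proof -
  define c where "c n = (b * real n) powr (1 / \<theta>)" for n
  have "(\<lambda>n. (1 - exp (- u / c n)) * c n) \<longlonglongrightarrow> u"
    unfolding c_def using assms by real_asymp
  then have D: "(\<lambda>n. ((1 - exp (- u / c n)) * c n) powr (- \<theta>)) \<longlonglongrightarrow> u powr (- \<theta>)"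
    using u by (intro tendsto_intros) auto
  have E: "(\<lambda>n. 1 / (b * real n)) \<longlonglongrightarrow> 0"
    using b by real_asymp
  have "(u powr (- \<theta>) + 1) / (0 + 1) \<noteq> 0"
    using powr_ge_zero[of u "- \<theta>"] by (simp add: add_nonneg_eq_0_iff)
  then have L: "(\<lambda>n. ((((1 - exp (- u / c n)) * c n) powr (- \<theta>) + 1) / (1 / (b * real n) + 1)) powr (- 1 / \<theta>))
      \<longlonglongrightarrow> ((u powr (- \<theta>) + 1) / (0 + 1)) powr (- 1 / \<theta>)"
    by (intro tendsto_powr[OF tendsto_divide[OF tendsto_add[OF D tendsto_const]
          tendsto_add[OF E tendsto_const]] tendsto_const]) auto
  have R: "((u powr (- \<theta>) + 1) / (0 + 1)) powr (- 1 / \<theta>) = (u powr \<theta> / (u powr \<theta> + 1)) powr (1 / \<theta>)"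
  proof -
    have "(u powr (- \<theta>) + 1) = inverse (u powr \<theta> / (u powr \<theta> + 1))"
      using u by (simp add: powr_minus field_simps)
    then show ?thesis
      by (simp add: powr_minus flip: inverse_powr)
  qed
  \<comment> \<open>The rewriting divides by \<open>b * real n\<close>, so it is made for
    \<open>n > 0\<close> only.\<close>
  have "\<forall>\<^sub>F n in sequentially.
      (((1 - exp (- u / c n)) * c n) powr (- \<theta>) + 1) / (1 / (b * real n) + 1)
      = ((1 - exp (- u / c n)) powr (- \<theta>) + b * real n) / (1 + b * real n)"
    using eventually_gt_at_top[of 0]
  proof eventually_elim
    case (elim n)
    then have bn: "0 < b * real n" using b by simp
    have c: "0 < c n" using elim b by (simp add: c_def)
    have "c n powr (- \<theta>) = 1 / (b * real n)"
      using bn \<theta> by (simp add: c_def powr_powr powr_minus divide_inverse)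
    then have "((1 - exp (- u / c n)) * c n) powr (- \<theta>) = (1 - exp (- u / c n)) powr (- \<theta>) / (b * real n)"
      using c u by (subst powr_mult) auto
    moreover have "(y / x + 1) / (1 / x + 1) = (y + x) / (1 + x)" if "0 < x" for x y :: real
    proof -
      have "(y / x + 1) / (1 / x + 1) = ((y + x) / x) / ((1 + x) / x)"
        using that by (simp add: add_divide_distrib)
      then show ?thesis using that by simp
    qed
    ultimately show ?case
      by (simp only: bn)
  qed
  then have ev: "\<forall>\<^sub>F n in sequentially.
      ((((1 - exp (- u / c n)) * c n) powr (- \<theta>) + 1) / (1 / (b * real n) + 1)) powr (- 1 / \<theta>)
      = (((1 - exp (- u / c n)) powr (- \<theta>) + b * real n) / (1 + b * real n)) powr (- 1 / \<theta>)"
    by (rule eventually_mono) (rule arg_cong[where f = "\<lambda>x. x powr (- 1 / \<theta>)"])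
  show ?thesis
    using Lim_transform_eventually[OF L ev] unfolding R c_def
    by (intro tendsto_diff tendsto_const)
qed

theorem theorem5p5:
  fixes \<theta> b :: real and p :: "nat pmf" and M :: "'a measure" and Z :: "nat \<Rightarrow> 'a \<Rightarrow> nat"
  assumes "0 < \<theta>" and "\<theta> \<le> 1" and "0 < b"
    and "is_PF \<theta> 1 b p"
    and "galton_watson M p Z"
  shows "((\<lambda>n. real n powr (1 / \<theta>) * \<P>(\<omega> in M. Z n \<omega> > 0)) \<longlonglongrightarrow> b powr (- 1 / \<theta>)) \<and>
         ((\<lambda>n. real n powr (- 1 / \<theta>) * (\<integral>\<omega>. real (Z n \<omega>) \<partial>(cond_survival M Z n)))
            \<longlonglongrightarrow> b powr (1 / \<theta>)) \<and>
         (\<exists>\<mu>. is_CPF_plus \<theta> 1 \<mu> \<and>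
            weak_conv_m
              (\<lambda>n. distr (cond_survival M Z n) borel (\<lambda>\<omega>. real (Z n \<omega>) / (b * real n) powr (1 / \<theta>)))
              \<mu>)"
proof -
  note \<theta> = assms(1) and b = assms(3) and p = assms(4) and gw = assms(5)
  interpret prob_space M using gw by (simp add: galton_watson_def)
  note [measurable] = galton_watson_measurable[OF gw]
  define S where "S n = {\<omega> \<in> space M. Z n \<omega> > 0}" for n
  have S[measurable]: "S n \<in> sets M" for n
    unfolding S_def by measurable
  have prob_S: "prob (S n) = (1 + b * real n) powr (- 1 / \<theta>)" for n
    unfolding S_def by (rule galton_watson_PF_survival[OF \<theta> b p gw])
  have bn1: "1 \<le> 1 + b * real n" for n
    using b by simp
  have S_pos: "0 < prob (S n)" for n
    unfolding prob_S using bn1[of n] by simp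
  have inv_S: "1 / prob (S n) = (1 + b * real n) powr (1 / \<theta>)" for n
    unfolding prob_S by (simp add: powr_minus divide_inverse)
  define C where "C n = cond_survival M Z n" for n
  have C: "C n = uniform_measure M (S n)" for n
    by (simp add: C_def cond_survival_def S_def)
  have [simp, measurable_cong]: "sets (C n) = sets M" for n
    by (simp add: C)
  have C_prob: "prob_space (C n)" for n
    unfolding C using S_pos[of n]
    by (intro prob_space_uniform_measure) (auto simp: emeasure_eq_measure)
  have C_int: "integral\<^sup>L (C n) f = (\<integral>\<omega>. indicator (S n) \<omega> * f \<omega> \<partial>M) / prob (S n)"
    if "f \<in> borel_measurable M" for f :: "'a \<Rightarrow> real" and n
    unfolding C by (rule integral_uniform_measure(1)[OF S S_pos that])
  \<comment> \<open>\<open>Z n\<close> vanishes off \<open>S n\<close>, so conditioning merely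
    divides the mean 1 by the survival probability.\<close>
  have Z_C: "(\<integral>\<omega>. real (Z n \<omega>) \<partial>C n) = (1 + b * real n) powr (1 / \<theta>)" for n
  proof -
    have "(\<integral>\<omega>. indicator (S n) \<omega> * real (Z n \<omega>) \<partial>M) = (\<integral>\<omega>. real (Z n \<omega>) \<partial>M)"
      by (rule Bochner_Integration.integral_cong) (auto simp: S_def indicator_def)
    then show ?thesis
      using C_int[of "\<lambda>\<omega>. real (Z n \<omega>)" n] galton_watson_PF_mean(2)[OF \<theta> b p gw, of n] inv_S[of n]
      by simp
  qed
  have Z_C_int: "integrable (C n) (\<lambda>\<omega>. real (Z n \<omega>))" for n
    unfolding C by (rule integral_uniform_measure(2)[OF S S_pos _ galton_watson_PF_mean(1)[OF \<theta> b p gw]]) simp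
  define c where "c n = (b * real n) powr (1 / \<theta>)" for n
  \<comment> \<open>Since \<open>c 0 = 0\<close> and division by zero gives 0,
    \<open>\<mu> 0\<close> is the point mass at 0; the bounds for all \<open>n\<close> must cover
    this case too.\<close>
  define \<mu> where "\<mu> n = distr (C n) borel (\<lambda>\<omega>. real (Z n \<omega>) / c n)" for n
  have Zc[measurable]: "(\<lambda>\<omega>. real (Z n \<omega>) / c n) \<in> borel_measurable (C n)" for n
    by measurable
  have c_nonneg: "0 \<le> c n" for n
    by (simp add: c_def)
  have nonneg: "AE x in \<mu> n. 0 \<le> x" for n
    unfolding \<mu>_def by (subst AE_distr_iff) (use c_nonneg in auto)
  have tight: "tight \<mu>"
  proof (rule tight_of_bounded_mean)
    fix n
    interpret C: prob_space "C n" by (rule C_prob)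
    show "real_distribution (\<mu> n)"
      unfolding \<mu>_def by (rule C.real_distribution_distr) (rule Zc)
    show "AE x in \<mu> n. 0 \<le> x"
      by (rule nonneg)
    show "integrable (\<mu> n) (\<lambda>x. x)"
      unfolding \<mu>_def by (subst integrable_distr_eq) (use Z_C_int in auto)
    have "(\<integral>x. x \<partial>\<mu> n) = (\<integral>\<omega>. real (Z n \<omega>) / c n \<partial>C n)"
      unfolding \<mu>_def by (subst integral_distr) auto
    also have "\<dots> = (1 + b * real n) powr (1 / \<theta>) / c n"
      by (simp add: Z_C)
    also have "\<dots> = ((1 + b * real n) / (b * real n)) powr (1 / \<theta>)"
      using b by (simp add: c_def powr_divide)
    \<comment> \<open>The quotient \<open>1 + 1 / (b * real n)\<close> decreases for
      \<open>n \<ge> 1\<close>, so its value at \<open>n = 1\<close> is the bound. At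
      \<open>n = 0\<close> the left side is 0 by division by zero.\<close>
    also have "\<dots> \<le> ((1 + b) / b) powr (1 / \<theta>)"
    proof (cases "n = 0")
      case False
      then show ?thesis
        using b \<theta> by (intro powr_mono2) (auto simp: field_simps)
    qed simp
    finally show "(\<integral>x. x \<partial>\<mu> n) \<le> ((1 + b) / b) powr (1 / \<theta>)" .
  qed
  have lim: "(\<lambda>n. laplace_transform (\<mu> n) u) \<longlonglongrightarrow> 1 - (u powr \<theta> / (u powr \<theta> + 1)) powr (1 / \<theta>)"
    if u: "0 \<le> u" for u
  \<comment> \<open>\<open>laplace_limit\<close> requires \<open>u > 0\<close>. At
    \<open>u = 0\<close> both sides are 1, because \<open>0 powr \<theta> = 0\<close>.\<close>
  proof (cases "u = 0")
    case True
    have "laplace_transform (\<mu> n) 0 = 1" for n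
    proof -
      interpret \<mu>: real_distribution "\<mu> n" using tight by (simp add: tight_def)
      show ?thesis using \<mu>.prob_space by (simp add: laplace_transform_def)
    qed
    then show ?thesis using True by simp
  next
    case False
    with u have u: "0 < u" by simp
    have "laplace_transform (\<mu> n) u
        = 1 - (((1 - exp (- u / c n)) powr (- \<theta>) + b * real n) / (1 + b * real n)) powr (- 1 / \<theta>)"
      if n: "0 < n" for n
    proof -
      have c: "0 < c n"
        using n b by (simp add: c_def)
      define s where "s = exp (- u / c n)"
      have s: "0 \<le> s" "s < 1"
        using u c by (auto simp: s_def)
      have int: "integrable M (\<lambda>\<omega>. t ^ Z n \<omega>)" if "0 \<le> t" "t < 1" for t :: real
        by (rule integrable_const_bound[where B = 1]) (use that in \<open>auto simp: power_le_one\<close>)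
      have exp_s: "exp (- u * (real (Z n \<omega>) / c n)) = s ^ Z n \<omega>" for \<omega>
        unfolding s_def by (simp add: field_simps flip: exp_of_nat_mult)
      have "laplace_transform (\<mu> n) u = (\<integral>\<omega>. s ^ Z n \<omega> \<partial>C n)"
        unfolding laplace_transform_def \<mu>_def by (subst integral_distr) (auto simp only: exp_s Zc, measurable)
      also have "\<dots> = (\<integral>\<omega>. indicator (S n) \<omega> * s ^ Z n \<omega> \<partial>M) / prob (S n)"
        by (rule C_int) measurable
      \<comment> \<open>On extinction both powers are 1, and on survival
        \<open>0 ^ Z n \<omega>\<close> is 0. The integral thus becomes a difference of generating
        function values at \<open>s\<close> and at 0.\<close>
      also have "(\<integral>\<omega>. indicator (S n) \<omega> * s ^ Z n \<omega> \<partial>M) = (\<integral>\<omega>. s ^ Z n \<omega> - 0 ^ Z n \<omega> \<partial>M)"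
        by (rule Bochner_Integration.integral_cong) (auto simp: S_def indicator_def)
      also have "\<dots> = prob (S n) - ((1 - s) powr (- \<theta>) + b * real n) powr (- 1 / \<theta>)"
        using int s galton_watson_PF_pgf[OF \<theta> b p gw s] galton_watson_PF_pgf[OF \<theta> b p gw, of 0 n]
        by (simp add: prob_S)
      also have "\<dots> / prob (S n)
          = 1 - ((1 - s) powr (- \<theta>) + b * real n) powr (- 1 / \<theta>) / prob (S n)"
        using S_pos[of n] by (simp add: diff_divide_distrib)
      also have "\<dots> = 1 - (((1 - s) powr (- \<theta>) + b * real n) / (1 + b * real n)) powr (- 1 / \<theta>)"
        using bn1[of n] b unfolding prob_S by (subst powr_divide) auto
      finally show ?thesis unfolding s_def .
    qed
    then have "\<And>n. 0 < n \<Longrightarrow>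
        1 - (((1 - exp (- u / c n)) powr (- \<theta>) + b * real n) / (1 + b * real n)) powr (- 1 / \<theta>)
        = laplace_transform (\<mu> n) u"
      by simp
    then have "\<forall>\<^sub>F n in sequentially.
        1 - (((1 - exp (- u / c n)) powr (- \<theta>) + b * real n) / (1 + b * real n)) powr (- 1 / \<theta>)
        = laplace_transform (\<mu> n) u"
      by (rule eventually_mono[OF eventually_gt_at_top[of 0]])
    with laplace_limit[OF \<theta> b u] show ?thesis
      unfolding c_def by (rule Lim_transform_eventually)
  qed
  obtain \<nu> where \<nu>: "real_distribution \<nu>" "AE x in \<nu>. 0 \<le> x"
    "\<And>u. 0 \<le> u \<Longrightarrow> laplace_transform \<nu> u = 1 - (u powr \<theta> / (u powr \<theta> + 1)) powr (1 / \<theta>)"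
    "weak_conv_m \<mu> \<nu>"
    using weak_conv_m_of_laplace_transform[OF tight nonneg lim] by blast
  \<comment> \<open>Weak convergence only places \<open>\<nu>\<close> on the closed halfline; the
    decay of its transform at infinity excludes an atom at 0.\<close>
  have "((\<lambda>u. 1 - (u powr \<theta> / (u powr \<theta> + 1)) powr (1 / \<theta>)) \<longlongrightarrow> 0) at_top"
    using \<theta> by real_asymp
  then have "(laplace_transform \<nu> \<longlongrightarrow> 0) at_top"
    by (rule Lim_transform_eventually) (rule eventually_mono[OF eventually_ge_at_top[of 0]], simp add: \<nu>(3))
  then have "AE x in \<nu>. 0 < x"
    by (rule AE_pos_of_laplace_transform[OF \<nu>(1,2)])
  then have "is_CPF_plus \<theta> 1 \<nu>"
    using \<nu>(1,3) by (simp add: is_CPF_plus_def)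
  moreover have "(\<lambda>n. real n powr (1 / \<theta>) * \<P>(\<omega> in M. Z n \<omega> > 0)) \<longlonglongrightarrow> b powr (- 1 / \<theta>)"
    using survival_limit[OF \<theta> b] by (simp add: galton_watson_PF_survival[OF \<theta> b p gw])
  moreover have "(\<lambda>n. real n powr (- 1 / \<theta>) * (\<integral>\<omega>. real (Z n \<omega>) \<partial>(cond_survival M Z n)))
      \<longlonglongrightarrow> b powr (1 / \<theta>)"
    using mean_limit[OF \<theta> b] by (simp add: Z_C[unfolded C_def])
  ultimately show ?thesis
    using \<nu>(4) unfolding \<mu>_def C_def c_def by blast
qed

end
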